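(* There is a universal constant $C_0>0$ such that the following holds. Let $n,M\ge1$, let $P_1,\dots,P_M,Q_1,\dots,Q_M\in\{I,X,Y,Z\}^{\otimes n}$ be Pauli operators such that $[P_i\otimes Q_i,P_j\otimes Q_j]=0$ for all pairs $(i,j)$, and let $\epsilon\in(0,1)$, $\delta\in(0,1/2]$. Then there is an algorithm which, for every $n$-qubit unitary $U$, with $Q_i(t)=U^\dagger Q_iU$, simultaneously estimates the $M$ two-point correlators $\left\{\mathrm{tr}(P_iQ_i(t))/2^n\right\}_{i=1}^M$ to additive error $\epsilon$ with success probability at least $1-\delta$ (all $M$ estimates simultaneously within $\epsilon$), using at most $C_0\log(M/\delta)/\epsilon^2$ samples of $|U\rangle\rangle_{\mathcal C}$, measured in a common eigenbasis of $\{Q_i\otimes P_i\}_{i=1}^M$.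
   Context: For an operator $X\neq0$ on $n$ qubits, its vectorization in the computational operator basis $\mathcal C=\{|i\rangle\langle j|\}$ is the $2n$-qubit unit vector $|X\rangle\rangle_{\mathcal C}=\frac{1}{\sqrt{\mathrm{tr}(X^\dagger X)}}\sum_{i,j}\langle i|X|j\rangle\,|i\rangle\otimes|j\rangle\in\mathcal H_L\otimes\mathcal H_R$, with $\mathcal H_L,\mathcal H_R\cong(\mathbb C^2)^{\otimes n}$. In $Q\otimes P$, the first factor acts on $\mathcal H_L$ and the second on $\mathcal H_R$. Each sample is an independent copy of the state, measured projectively in an orthonormal basis of common eigenvectors of all $Q_i\otimes P_i$. An "algorithm" is a classical post-processing of the measurement outcomes which may depend on $n,M,\epsilon,\delta$ and the $P_i,Q_i$, but has no access to $U$ other than through the outcomes. *)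

theory Defs
  imports
    "HOL-Probability.Probability_Mass_Function"
    "Jordan_Normal_Form.Schur_Decomposition"
begin

unbundle no inner_syntax
no_notation vec_nth (infixl \<open>$\<close> 90)
hide_type (open) Finite_Cartesian_Product.vec
hide_const (open) Finite_Cartesian_Product.vec Finite_Cartesian_Product.mat

definition mat_trace :: "complex mat \<Rightarrow> complex" where
  "mat_trace A = (\<Sum>i<dim_row A. A $$ (i, i))"

text \<open>The computational basis of a tensor product is ordered lexicographically:
  \<open>|i\<rangle> \<otimes> |j\<rangle>\<close> is the basis vector with index \<open>i * d + j\<close>, where \<open>d\<close> is the dimension of the
  second factor.\<close>

definition kron :: "complex mat \<Rightarrow> complex mat \<Rightarrow> complex mat" where
  "kron A B = mat (dim_row A * dim_row B) (dim_col A * dim_col B)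
     (\<lambda>(i, j). A $$ (i div dim_row B, j div dim_col B) * B $$ (i mod dim_row B, j mod dim_col B))"

datatype pauli = PI | PX | PY | PZ

fun pauli_mat :: "pauli \<Rightarrow> complex mat" where
  "pauli_mat PI = mat_of_rows_list 2 [[1, 0], [0, 1]]"
| "pauli_mat PX = mat_of_rows_list 2 [[0, 1], [1, 0]]"
| "pauli_mat PY = mat_of_rows_list 2 [[0, - \<i>], [\<i>, 0]]"
| "pauli_mat PZ = mat_of_rows_list 2 [[1, 0], [0, - 1]]"

text \<open>A list of \<open>n\<close> Pauli letters denotes an element of \<open>{I,X,Y,Z}\<close> to the \<open>n\<close>-th tensor power.\<close>

fun pauli_op :: "pauli list \<Rightarrow> complex mat" where
  "pauli_op [] = 1\<^sub>m 1"
| "pauli_op (p # ps) = kron (pauli_mat p) (pauli_op ps)"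

definition unitary_op :: "nat \<Rightarrow> complex mat \<Rightarrow> bool" where
  "unitary_op d U \<longleftrightarrow>
     U \<in> carrier_mat d d \<and> mat_adjoint U * U = 1\<^sub>m d \<and> U * mat_adjoint U = 1\<^sub>m d"

text \<open>The entry with index \<open>i * d + j\<close> is \<open>\<langle>i|X|j\<rangle>\<close>, divided by the root of \<open>tr (X\<^sup>\<dagger> X)\<close>, a
  nonnegative real number.  The index \<open>i\<close> belongs to the left factor.\<close>

definition vectorize :: "complex mat \<Rightarrow> complex vec" where
  "vectorize X = vec (dim_row X * dim_col X)
     (\<lambda>k. X $$ (k div dim_col X, k mod dim_col X) / csqrt (mat_trace (mat_adjoint X * X)))"

text \<open>In dimension \<open>d\<close>, a set of \<open>d\<close> orthonormal vectors is automatically spanning.\<close>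

definition orthonormal_basis :: "nat \<Rightarrow> complex vec set \<Rightarrow> bool" where
  "orthonormal_basis d B \<longleftrightarrow>
     B \<subseteq> carrier_vec d \<and> finite B \<and> card B = d \<and>
     (\<forall>b\<in>B. \<forall>c\<in>B. b \<bullet>c c = (if b = c then 1 else 0))"

definition common_eigenbasis :: "nat \<Rightarrow> complex mat set \<Rightarrow> complex vec set \<Rightarrow> bool" where
  "common_eigenbasis d \<A> B \<longleftrightarrow>
     orthonormal_basis d B \<and> (\<forall>A\<in>\<A>. \<forall>b\<in>B. \<exists>l. eigenvector A b l)"

text \<open>Projective measurement of the state vector \<open>v\<close> in the basis \<open>B\<close>; the outcome is the basis
  vector that is found.  Since \<open>\<bullet>c\<close> conjugates its second argument, \<open>v \<bullet>c b\<close> is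
  \<open>\<langle>b|v\<rangle>\<close>.  The weights sum to one for a unit vector, see \<open>pmf_measurement\<close> below.\<close>

definition measurement :: "complex vec set \<Rightarrow> complex vec \<Rightarrow> complex vec pmf" where
  "measurement B v = embed_pmf (\<lambda>b. if b \<in> B then (cmod (v \<bullet>c b))\<^sup>2 else 0)"

definition correlator :: "nat \<Rightarrow> complex mat \<Rightarrow> complex mat \<Rightarrow> complex mat \<Rightarrow> complex" where
  "correlator n U P Q = mat_trace (P * (mat_adjoint U * Q * U)) / 2 ^ n"

lemma parseval:
  assumes B: "orthonormal_basis d B" and v: "v \<in> carrier_vec d"
  shows "(\<Sum>b\<in>B. (cmod (v \<bullet>c b))\<^sup>2) = Re (v \<bullet>c v)"
proof -
  have fin: "finite B" and card: "card B = d" and Bc: "B \<subseteq> carrier_vec d"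
    and on: "\<And>b c. b \<in> B \<Longrightarrow> c \<in> B \<Longrightarrow> b \<bullet>c c = (if b = c then 1 else 0)"
    using B by (auto simp: orthonormal_basis_def)
  obtain bs where bs: "set bs = B" "distinct bs" "length bs = d"
    using finite_distinct_list[OF fin] card distinct_card by metis
  have bc: "bs ! i \<in> carrier_vec d" if "i < d" for i
    using that bs Bc nth_mem by (metis subsetD)
  have dim: "dim_vec (bs ! i) = d" if "i < d" for i using bc[OF that] by auto
  define W where "W = mat d d (\<lambda>(i, j). cnj (bs ! i $ j))"
  define W' where "W' = mat d d (\<lambda>(i, j). bs ! j $ i)"
  have W: "W \<in> carrier_mat d d" "W' \<in> carrier_mat d d" by (auto simp: W_def W'_def)
  have "W * W' = 1\<^sub>m d"
  proof (rule eq_matI)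
    fix i j assume ij: "i < dim_row (1\<^sub>m d :: complex mat)" "j < dim_col (1\<^sub>m d :: complex mat)"
    then have ij': "i < d" "j < d" by auto
    have "(W * W') $$ (i, j) = bs ! j \<bullet>c bs ! i"
      using ij' dim by (simp add: W_def W'_def scalar_prod_def row_def col_def mult.commute)
    also have "\<dots> = (if i = j then 1 else 0)"
      using on[of "bs ! j" "bs ! i"] bs ij' by (auto simp: nth_eq_iff_index_eq)
    finally show "(W * W') $$ (i, j) = (1\<^sub>m d) $$ (i, j)" using ij' by simp
  qed (use W in auto)
  then have WW: "W' * W = 1\<^sub>m d" by (rule mat_mult_left_right_inverse[OF W])
  have comp: "(\<Sum>k<d. bs ! k $ i * cnj (bs ! k $ j)) = (if i = j then 1 else 0)"
    if "i < d" "j < d" for i j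
  proof -
    have "(W' * W) $$ (i, j) = (\<Sum>k<d. bs ! k $ i * cnj (bs ! k $ j))"
      using that by (simp add: W_def W'_def scalar_prod_def row_def col_def lessThan_atLeast0)
    then show ?thesis using WW that by simp
  qed
  have sp: "v \<bullet>c bs ! k = (\<Sum>i<d. v $ i * cnj (bs ! k $ i))" if "k < d" for k
    using dim[OF that] by (simp add: scalar_prod_def lessThan_atLeast0)
  have "complex_of_real (\<Sum>b\<in>B. (cmod (v \<bullet>c b))\<^sup>2) = (\<Sum>b\<in>B. (v \<bullet>c b) * cnj (v \<bullet>c b))"
    by (simp only: of_real_sum complex_norm_square)
  also have "\<dots> = (\<Sum>k<d. (v \<bullet>c bs ! k) * cnj (v \<bullet>c bs ! k))"
    by (rule sum.reindex_bij_betw[symmetric]) (use bs bij_betw_nth in blast)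
  also have "\<dots> = (\<Sum>k<d. \<Sum>i<d. \<Sum>j<d. v $ i * cnj (v $ j) * (bs ! k $ j * cnj (bs ! k $ i)))"
    by (intro sum.cong refl) (simp add: sp sum_product mult_ac)
  also have "\<dots> = (\<Sum>i<d. \<Sum>j<d. \<Sum>k<d. v $ i * cnj (v $ j) * (bs ! k $ j * cnj (bs ! k $ i)))"
    by (subst sum.swap, rule sum.cong[OF refl], subst sum.swap, rule refl)
  also have "\<dots> = (\<Sum>i<d. \<Sum>j<d. v $ i * cnj (v $ j) * (if j = i then 1 else 0))"
    by (intro sum.cong refl) (simp add: comp sum_distrib_left[symmetric])
  also have "\<dots> = (\<Sum>i<d. v $ i * cnj (v $ i))"
    by (intro sum.cong refl) (simp add: if_distrib cong: if_cong)
  also have "\<dots> = v \<bullet>c v"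
    using v by (simp add: scalar_prod_def lessThan_atLeast0)
  finally show ?thesis by (metis Re_complex_of_real)
qed

lemma pmf_measurement:
  assumes B: "orthonormal_basis d B" and v: "v \<in> carrier_vec d" "v \<bullet>c v = 1"
  shows "pmf (measurement B v) b = (if b \<in> B then (cmod (v \<bullet>c b))\<^sup>2 else 0)"
  unfolding measurement_def
proof (rule pmf_embed_pmf)
  have fin: "finite B" using B by (simp add: orthonormal_basis_def)
  have "(\<integral>\<^sup>+x. ennreal (if x \<in> B then (cmod (v \<bullet>c x))\<^sup>2 else 0) \<partial>count_space UNIV)
      = (\<integral>\<^sup>+x. ennreal ((cmod (v \<bullet>c x))\<^sup>2) \<partial>count_space B)"
    by (subst nn_integral_count_space_indicator)
       (auto intro!: nn_integral_cong split: split_indicator)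
  also have "\<dots> = ennreal (\<Sum>b\<in>B. (cmod (v \<bullet>c b))\<^sup>2)"
    using fin by (simp add: nn_integral_count_space_finite)
  also have "\<dots> = 1" using parseval[OF B v(1)] v(2) by simp
  finally show "(\<integral>\<^sup>+x. ennreal (if x \<in> B then (cmod (v \<bullet>c x))\<^sup>2 else 0) \<partial>count_space UNIV) = 1" .
qed auto

lemma vectorize_unitary_op:
  assumes U: "unitary_op d U" and d: "0 < d"
  shows "vectorize U \<in> carrier_vec (d * d)" "vectorize U \<bullet>c vectorize U = 1"
proof -
  have Uc: "U \<in> carrier_mat d d" "dim_row U = d" "dim_col U = d"
    and UU: "mat_adjoint U * U = 1\<^sub>m d"
    using U by (auto simp: unitary_op_def)
  show "vectorize U \<in> carrier_vec (d * d)" using Uc by (simp add: vectorize_def)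
  have adj: "mat_adjoint U = mat d d (\<lambda>(i, j). cnj (U $$ (j, i)))"
    using Uc by (auto simp: mat_adjoint_def mat_of_rows_def cols_def)
  have tr: "mat_trace (mat_adjoint U * U) = of_nat d" by (simp add: UU mat_trace_def)
  have cs: "csqrt (of_nat d) = of_real (sqrt d)"
    using of_real_sqrt[of "real d"] by simp
  have colsum: "(\<Sum>i<d. cnj (U $$ (i, j)) * U $$ (i, j)) = 1" if "j < d" for j
  proof -
    have "(mat_adjoint U * U) $$ (j, j) = (\<Sum>i<d. cnj (U $$ (i, j)) * U $$ (i, j))"
      using that Uc by (simp add: adj scalar_prod_def row_def col_def lessThan_atLeast0)
    then show ?thesis using that by (simp add: UU)
  qed
  have bound: "i * d + j < d * d" if "i < d" "j < d" for i j
  proof -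
    have "i * d + j < Suc i * d" using that by simp
    also have "\<dots> \<le> d * d" using that by (intro mult_right_mono) auto
    finally show ?thesis .
  qed
  have "vectorize U \<bullet>c vectorize U
      = (\<Sum>k<d * d. cnj (U $$ (k div d, k mod d)) * U $$ (k div d, k mod d) / of_nat d)"
  proof -
    have sq: "complex_of_real (sqrt d) * complex_of_real (sqrt d) = of_nat d"
      by (simp flip: of_real_mult)
    show ?thesis
      using Uc by (simp add: vectorize_def scalar_prod_def tr cs sq lessThan_atLeast0 mult.commute)
  qed
  also have "\<dots> = (\<Sum>(i, j)\<in>{..<d} \<times> {..<d}. cnj (U $$ (i, j)) * U $$ (i, j) / of_nat d)"
    by (rule sum.reindex_bij_witness[of _ "\<lambda>(i, j). i * d + j" "\<lambda>k. (k div d, k mod d)"])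
       (use d bound in \<open>auto simp: less_mult_imp_div_less\<close>)
  also have "\<dots> = (\<Sum>j<d. \<Sum>i<d. cnj (U $$ (i, j)) * U $$ (i, j) / of_nat d)"
    by (subst sum.swap) (simp add: sum.cartesian_product)
  also have "\<dots> = (\<Sum>j<d. 1 / of_nat d)"
    by (intro sum.cong refl) (simp add: colsum sum_divide_distrib[symmetric])
  also have "\<dots> = 1" using d by simp
  finally show "vectorize U \<bullet>c vectorize U = 1" .
qed

end

theory Submission
  imports Defs "HOL-Probability.Hoeffding"
begin

text \<open>
  Write \<open>A = Q \<otimes> P\<close> and \<open>v = |U\<rangle>\<rangle>\<close>.  Since \<open>(Q \<otimes> P) |U\<rangle>\<rangle> = |Q U P\<^sup>T\<rangle>\<rangle>\<close> and \<open>P\<^sup>T = \<plusminus> P\<close>, the sign being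
  the parity of the number of letters \<open>Y\<close> in \<open>P\<close>, the correlator equals \<open>\<plusminus> \<langle>v|A|v\<rangle>\<close>, which is the
  mean of the \<open>\<plusminus>1\<close>-valued eigenvalue of \<open>A\<close> at the measured basis vector.  A single string of \<open>N\<close>
  outcomes therefore serves all \<open>M\<close> empirical means, and Hoeffding's inequality with a union bound
  gives failure probability at most \<open>2 M exp (- N \<epsilon>\<^sup>2 / 2)\<close>.
\<close>

unbundle no inner_syntax
no_notation vec_nth (infixl \<open>$\<close> 90)
hide_type (open) Finite_Cartesian_Product.vec
hide_const (open) Finite_Cartesian_Product.vec Finite_Cartesian_Product.mat

section \<open>Hoeffding's inequality for lists of independent samples\<close>

text \<open>Independence of the draws, in the form needed to factor a moment generating function.
  Taking values in \<open>ennreal\<close> lets constants be pulled out of the iterated integrals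
  without integrability side conditions.\<close>

lemma nn_integral_replicate_pmf_prod_list:
  fixes g :: "'a \<Rightarrow> ennreal"
  shows "(\<integral>\<^sup>+xs. prod_list (map g xs) \<partial>measure_pmf (replicate_pmf N p))
       = (\<integral>\<^sup>+x. g x \<partial>measure_pmf p) ^ N"
proof (induction N)
  case (Suc N)
  have "(\<integral>\<^sup>+xs. prod_list (map g xs) \<partial>measure_pmf (replicate_pmf (Suc N) p))
      = (\<integral>\<^sup>+x. \<integral>\<^sup>+xs. g x * prod_list (map g xs) \<partial>measure_pmf (replicate_pmf N p) \<partial>measure_pmf p)"
    by simp
  also have "\<dots> = (\<integral>\<^sup>+x. g x * (\<integral>\<^sup>+x. g x \<partial>measure_pmf p) ^ N \<partial>measure_pmf p)"
    by (simp add: nn_integral_cmult Suc)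
  also have "\<dots> = (\<integral>\<^sup>+x. g x \<partial>measure_pmf p) ^ Suc N"
    by (simp add: nn_integral_multc)
  finally show ?case .
qed simp

lemma ennreal_exp_sum_list:
  "ennreal (exp (s * sum_list (map f xs))) = prod_list (map (\<lambda>x. ennreal (exp (s * f x))) xs)"
  by (induction xs) (simp_all add: distrib_left exp_add ennreal_mult)

text \<open>Chernoff's method: the exponential moment of the centred sum is an \<open>N\<close>-th
  power, and Hoeffding's lemma bounds each factor by \<open>exp (e\<^sup>2 / 2)\<close>, because
  \<open>g\<close> takes values in an interval of length 2.\<close>

lemma Hoeffding_replicate_pmf_ge:
  fixes f :: "'a \<Rightarrow> real"
  assumes f: "\<And>x. \<bar>f x\<bar> \<le> 1" and e: "0 < e"
  shows "measure_pmf.prob (replicate_pmf N p)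
      {xs. real N * (measure_pmf.expectation p f + e) \<le> sum_list (map f xs)} \<le> exp (- real N * e\<^sup>2 / 2)"
proof -
  define \<mu> where "\<mu> = measure_pmf.expectation p f"
  define g where "g = (\<lambda>x. f x - \<mu>)"
  define A where "A = {xs. real N * (\<mu> + e) \<le> sum_list (map f xs)}"
  have int: "integrable (measure_pmf p) f"
    by (rule measure_pmf.integrable_const_bound[of _ 1]) (use f in auto)
  interpret interval_bounded_random_variable "measure_pmf p" g "- 1 - \<mu>" "1 - \<mu>"
    by unfold_locales (use f in \<open>auto simp: g_def abs_le_iff minus_le_iff\<close>)
  have E: "measure_pmf.expectation p g = 0"
    using int by (simp add: g_def \<mu>_def)
  have sum_g: "sum_list (map g xs) = sum_list (map f xs) - real N * \<mu>" if "length xs = N" for xs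
    using that by (simp add: g_def sum_list_subtractf sum_list_triv)
  \<comment> \<open>Subtracting \<open>real N * \<mu>\<close> from the sum is correct only for lists
    of length \<open>N\<close>, so the two events are compared on the support of
    \<open>replicate_pmf N p\<close>.\<close>
  have "emeasure (replicate_pmf N p) A
      = emeasure (replicate_pmf N p) {xs\<in>UNIV. real N * e \<le> sum_list (map g xs)}"
    by (rule emeasure_eq_AE)
       (auto simp: AE_measure_pmf_iff set_replicate_pmf A_def sum_g algebra_simps)
  \<comment> \<open>The free parameter \<open>t\<close> of the exponential moment is set to
    \<open>e\<close>, which minimizes the exponent \<open>- t * e + t\<^sup>2 / 2\<close> per sample
    and leaves \<open>- e\<^sup>2 / 2\<close>.\<close>
  also have "\<dots> \<le> ennreal (exp (- e * (real N * e))) *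
      (\<integral>\<^sup>+xs. ennreal (exp (e * sum_list (map g xs))) * indicator UNIV xs \<partial>measure_pmf (replicate_pmf N p))"
    by (rule Chernoff_ineq_nn_integral_ge) (use e in auto)
  also have "\<dots> = ennreal (exp (- e * (real N * e))) *
      (\<integral>\<^sup>+x. ennreal (exp (e * g x)) \<partial>measure_pmf p) ^ N"
    by (simp add: ennreal_exp_sum_list nn_integral_replicate_pmf_prod_list)
  also have "\<dots> \<le> ennreal (exp (- e * (real N * e))) * ennreal (exp (e\<^sup>2 * (1 - \<mu> - (- 1 - \<mu>))\<^sup>2 / 8)) ^ N"
    by (intro mult_left_mono power_mono Hoeffdings_lemma_nn_integral_0 e E) auto
  also have "\<dots> = ennreal (exp (- e * (real N * e)) * exp (e\<^sup>2 / 2) ^ N)"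
    by (simp add: ennreal_power ennreal_mult)
  also have "exp (- e * (real N * e)) * exp (e\<^sup>2 / 2) ^ N = exp (- real N * e\<^sup>2 / 2)"
    by (simp add: exp_of_nat_mult[symmetric] exp_add[symmetric] power2_eq_square field_simps)
  finally show ?thesis
    by (simp add: A_def \<mu>_def measure_pmf.emeasure_eq_measure)
qed

text \<open>The lower tail of \<open>f\<close> is the upper tail of \<open>- f\<close>, whence the
  factor 2.\<close>

lemma Hoeffding_replicate_pmf:
  fixes f :: "'a \<Rightarrow> real"
  assumes f: "\<And>x. \<bar>f x\<bar> \<le> 1" and e: "0 < e" and N: "0 < N"
  shows "measure_pmf.prob (replicate_pmf N p)
      {xs. e < \<bar>sum_list (map f xs) / real N - measure_pmf.expectation p f\<bar>} \<le> 2 * exp (- real N * e\<^sup>2 / 2)"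
proof -
  define A where "A = (\<lambda>f :: 'a \<Rightarrow> real.
    {xs. real N * (measure_pmf.expectation p f + e) \<le> sum_list (map f xs)})"
  have neg: "sum_list (map (\<lambda>x. - f x) xs) = - sum_list (map f xs)" for xs
    by (induction xs) auto
  have "{xs. e < \<bar>sum_list (map f xs) / real N - measure_pmf.expectation p f\<bar>} \<subseteq> A f \<union> A (\<lambda>x. - f x)"
    using N by (auto simp: A_def neg abs_if field_simps split: if_splits)
  then have "measure_pmf.prob (replicate_pmf N p)
      {xs. e < \<bar>sum_list (map f xs) / real N - measure_pmf.expectation p f\<bar>}
    \<le> measure_pmf.prob (replicate_pmf N p) (A f \<union> A (\<lambda>x. - f x))"
    by (intro measure_pmf.finite_measure_mono) auto
  also have "\<dots> \<le> measure_pmf.prob (replicate_pmf N p) (A f)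
      + measure_pmf.prob (replicate_pmf N p) (A (\<lambda>x. - f x))"
    by (rule measure_Un_le) auto
  also have "\<dots> \<le> exp (- real N * e\<^sup>2 / 2) + exp (- real N * e\<^sup>2 / 2)"
    unfolding A_def by (intro add_mono Hoeffding_replicate_pmf_ge e) (use f in auto)
  finally show ?thesis by simp
qed

section \<open>Kronecker products in lexicographic index order\<close>

text \<open>Quotient and remainder identify an index of the tensor product with a pair of indices of
  the factors. This turns every contraction over the product space into a double sum.\<close>

lemma sum_div_mod:
  fixes f :: "nat \<Rightarrow> nat \<Rightarrow> 'a :: comm_monoid_add"
  shows "(\<Sum>k<m * n. f (k div n) (k mod n)) = (\<Sum>i<m. \<Sum>j<n. f i j)"
proof (cases "n = 0")
  case False
  have bound: "i * n + j < m * n" if "i < m" "j < n" for i j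
  proof -
    have "i * n + j < Suc i * n" using that by simp
    also have "\<dots> \<le> m * n" using that by (intro mult_right_mono) auto
    finally show ?thesis .
  qed
  have "(\<Sum>k<m * n. f (k div n) (k mod n)) = (\<Sum>(i, j)\<in>{..<m} \<times> {..<n}. f i j)"
    by (rule sum.reindex_bij_witness[of _ "\<lambda>(i, j). i * n + j" "\<lambda>k. (k div n, k mod n)"])
       (use False bound in \<open>auto simp: less_mult_imp_div_less\<close>)
  then show ?thesis by (simp add: sum.cartesian_product)
qed simp

lemma kron_carrier [simp]:
  "A \<in> carrier_mat a b \<Longrightarrow> B \<in> carrier_mat c d \<Longrightarrow> kron A B \<in> carrier_mat (a * c) (b * d)"
  by (auto simp: kron_def)

lemma index_kron:
  assumes "A \<in> carrier_mat a b" "B \<in> carrier_mat c d" "i < a * c" "j < b * d"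
  shows "kron A B $$ (i, j) = A $$ (i div c, j div d) * B $$ (i mod c, j mod d)"
  using assms by (auto simp: kron_def)

lemma index_mult_mat_sum:
  assumes "A \<in> carrier_mat a b" "B \<in> carrier_mat b c" "i < a" "j < c"
  shows "(A * B) $$ (i, j) = (\<Sum>k<b. A $$ (i, k) * B $$ (k, j))"
  using assms by (simp add: scalar_prod_def lessThan_atLeast0)

lemma mod_less_mult: "(i :: nat) < a * c \<Longrightarrow> i mod c < c"
  by (cases "c = 0") auto

text \<open>The mixed-product property: once the contracted index is split, the summand separates
  and the double sum is a product of two sums. It reduces the square of a Pauli string to the
  squares of its letters.\<close>

lemma kron_mult:
  assumes A: "A \<in> carrier_mat a b" and B: "B \<in> carrier_mat c d"
    and C: "C \<in> carrier_mat b e" and D: "D \<in> carrier_mat d f"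
  shows "kron A B * kron C D = kron (A * C) (B * D)"
proof (rule eq_matI)
  have AC: "A * C \<in> carrier_mat a e" and BD: "B * D \<in> carrier_mat c f" using assms by auto
  fix i j assume "i < dim_row (kron (A * C) (B * D))" "j < dim_col (kron (A * C) (B * D))"
  then have ij: "i < a * c" "j < e * f" using kron_carrier[OF AC BD] by auto
  have ij': "i div c < a" "i mod c < c" "j div f < e" "j mod f < f"
    using ij by (auto simp: less_mult_imp_div_less mod_less_mult)
  have "(kron A B * kron C D) $$ (i, j) = (\<Sum>k<b * d. kron A B $$ (i, k) * kron C D $$ (k, j))"
    by (rule index_mult_mat_sum[OF kron_carrier[OF A B] kron_carrier[OF C D] ij])
  also have "\<dots> = (\<Sum>k<b * d. (A $$ (i div c, k div d) * C $$ (k div d, j div f)) *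
      (B $$ (i mod c, k mod d) * D $$ (k mod d, j mod f)))"
    using ij by (intro sum.cong refl) (simp add: index_kron[OF A B] index_kron[OF C D])
  also have "\<dots> = (\<Sum>k<b. \<Sum>l<d. (A $$ (i div c, k) * C $$ (k, j div f)) *
      (B $$ (i mod c, l) * D $$ (l, j mod f)))"
    by (rule sum_div_mod)
  also have "\<dots> = (A * C) $$ (i div c, j div f) * (B * D) $$ (i mod c, j mod f)"
    using ij' by (simp add: index_mult_mat_sum[OF A C] index_mult_mat_sum[OF B D] sum_product)
  also have "\<dots> = kron (A * C) (B * D) $$ (i, j)"
    by (rule index_kron[OF AC BD ij, symmetric])
  finally show "(kron A B * kron C D) $$ (i, j) = kron (A * C) (B * D) $$ (i, j)" .
qed (use assms in \<open>auto simp: kron_def\<close>)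

lemma kron_one: "kron (1\<^sub>m a) (1\<^sub>m b) = 1\<^sub>m (a * b)"
proof (rule eq_matI)
  fix i j assume "i < dim_row (1\<^sub>m (a * b) :: complex mat)" "j < dim_col (1\<^sub>m (a * b) :: complex mat)"
  then have ij: "i < a * b" "j < a * b" by auto
  have eq: "i = j \<longleftrightarrow> i div b = j div b \<and> i mod b = j mod b"
    by (metis div_mult_mod_eq)
  show "kron (1\<^sub>m a) (1\<^sub>m b) $$ (i, j) = 1\<^sub>m (a * b) $$ (i, j)"
    using ij by (simp add: index_kron[of _ a a _ b b] less_mult_imp_div_less mod_less_mult) (use eq in auto)
qed (auto simp: kron_def)

text \<open>Conjugation with the unitary that swaps the two tensor factors.\<close>

definition swap_factors :: "nat \<Rightarrow> complex mat \<Rightarrow> complex mat" where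
  "swap_factors d A = mat (d * d) (d * d) (\<lambda>(i, j). A $$ ((i mod d) * d + i div d, (j mod d) * d + j div d))"

lemma swap_index_less:
  assumes "i < d * (d :: nat)"
  shows "(i mod d) * d + i div d < d * d"
proof -
  have "i div d < d" "i mod d < d" using assms by (auto simp: less_mult_imp_div_less mod_less_mult)
  then have "(i mod d) * d + i div d < Suc (i mod d) * d" by simp
  also have "\<dots> \<le> d * d" using \<open>i mod d < d\<close> by (intro mult_right_mono) auto
  finally show ?thesis .
qed

lemma swap_factors_kron:
  assumes A: "A \<in> carrier_mat d d" and B: "B \<in> carrier_mat d d"
  shows "swap_factors d (kron A B) = kron B A"
proof (rule eq_matI)
  fix i j assume "i < dim_row (kron B A)" "j < dim_col (kron B A)"
  then have ij: "i < d * d" "j < d * d" using kron_carrier[OF B A] by auto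
  have "i div d < d" "j div d < d" using ij by (auto simp: less_mult_imp_div_less)
  then show "swap_factors d (kron A B) $$ (i, j) = kron B A $$ (i, j)"
    using ij by (simp add: swap_factors_def index_kron[OF A B] index_kron[OF B A] swap_index_less)
qed (use assms in \<open>auto simp: kron_def swap_factors_def\<close>)

text \<open>The index map \<open>s\<close> exchanges quotient and remainder and is an involution of
  the indices, so reindexing the contracted sum by \<open>s\<close> inserts it between the two
  matrices.\<close>

lemma swap_factors_mult:
  assumes A: "A \<in> carrier_mat (d * d) (d * d)" and B: "B \<in> carrier_mat (d * d) (d * d)"
  shows "swap_factors d (A * B) = swap_factors d A * swap_factors d B"
proof (rule eq_matI)
  define s where "s = (\<lambda>i. (i mod d) * d + i div d)"
  have C: "swap_factors d X \<in> carrier_mat (d * d) (d * d)" for X by (simp add: swap_factors_def)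
  have sw: "swap_factors d X $$ (i, j) = X $$ (s i, s j)" if "i < d * d" "j < d * d" for X i j
    using that by (simp add: swap_factors_def s_def)
  have s_less: "s k < d * d" if "k < d * d" for k
    using that by (simp add: s_def swap_index_less)
  have ss: "s (s k) = k" if "k < d * d" for k
    using that by (cases "d = 0") (simp_all add: s_def less_mult_imp_div_less)
  fix i j assume "i < dim_row (swap_factors d A * swap_factors d B)" "j < dim_col (swap_factors d A * swap_factors d B)"
  then have ij: "i < d * d" "j < d * d" by (auto simp: swap_factors_def)
  have "swap_factors d (A * B) $$ (i, j) = (\<Sum>k<d * d. A $$ (s i, k) * B $$ (k, s j))"
    using ij by (simp add: sw s_less index_mult_mat_sum[OF A B] del: index_mult_mat)
  also have "\<dots> = (\<Sum>k<d * d. A $$ (s i, s k) * B $$ (s k, s j))"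
    by (rule sum.reindex_bij_witness[of _ s s]) (simp_all add: ss s_less)
  also have "\<dots> = (swap_factors d A * swap_factors d B) $$ (i, j)"
    using ij by (simp add: index_mult_mat_sum[OF C C] sw del: index_mult_mat)
  finally show "swap_factors d (A * B) $$ (i, j) = (swap_factors d A * swap_factors d B) $$ (i, j)" .
qed (use assms in \<open>auto simp: swap_factors_def\<close>)

text \<open>The theorem assumes commutation of the operators P \<otimes> Q, whereas the measured
  operators are Q \<otimes> P. Swapping the factors is multiplicative and carries the relation
  over.\<close>

lemma commute_kron_swap:
  assumes C: "A \<in> carrier_mat d d" "B \<in> carrier_mat d d" "A' \<in> carrier_mat d d" "B' \<in> carrier_mat d d"
    and comm: "kron A B * kron A' B' = kron A' B' * kron A B"
  shows "kron B A * kron B' A' = kron B' A' * kron B A"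
proof -
  have "kron B A * kron B' A' = swap_factors d (kron A B * kron A' B')"
    using C by (simp add: swap_factors_mult swap_factors_kron)
  also have "\<dots> = kron B' A' * kron B A"
    using C unfolding comm by (simp add: swap_factors_mult swap_factors_kron)
  finally show ?thesis .
qed

section \<open>Pauli strings as Hermitian involutions\<close>

text \<open>Isolates what the measurement argument and the eigenbasis construction use of Pauli
  strings. Hermiticity is stated entrywise because it is checked on the entries of Kronecker
  products and applied inside index sums.\<close>

definition hermitian_involution :: "nat \<Rightarrow> complex mat \<Rightarrow> bool" where
  "hermitian_involution d A \<longleftrightarrow> A \<in> carrier_mat d d \<and> A * A = 1\<^sub>m d \<and>
     (\<forall>i<d. \<forall>j<d. A $$ (i, j) = cnj (A $$ (j, i)))"

lemma hermitian_involutionI: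
  assumes "A \<in> carrier_mat d d" "A * A = 1\<^sub>m d"
    "\<And>i j. i < d \<Longrightarrow> j < d \<Longrightarrow> A $$ (i, j) = cnj (A $$ (j, i))"
  shows "hermitian_involution d A"
  using assms unfolding hermitian_involution_def by blast

lemma hermitian_involutionD:
  assumes "hermitian_involution d A"
  shows "A \<in> carrier_mat d d" "A * A = 1\<^sub>m d"
    "\<And>i j. i < d \<Longrightarrow> j < d \<Longrightarrow> A $$ (i, j) = cnj (A $$ (j, i))"
  using assms unfolding hermitian_involution_def by blast+

lemma hermitian_involution_kron:
  assumes A: "hermitian_involution a A" and B: "hermitian_involution b B"
  shows "hermitian_involution (a * b) (kron A B)"
proof -
  note C = hermitian_involutionD(1)[OF A] hermitian_involutionD(1)[OF B]
  show ?thesis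
  proof (rule hermitian_involutionI[OF kron_carrier[OF C]])
    show "kron A B * kron A B = 1\<^sub>m (a * b)"
      by (simp add: kron_mult[OF C C] hermitian_involutionD(2)[OF A] hermitian_involutionD(2)[OF B] kron_one)
    fix i j assume "i < a * b" "j < a * b"
    then show "kron A B $$ (i, j) = cnj (kron A B $$ (j, i))"
      using hermitian_involutionD(3)[OF A, of "i div b" "j div b"]
        hermitian_involutionD(3)[OF B, of "i mod b" "j mod b"]
      by (simp add: index_kron[OF C] less_mult_imp_div_less mod_less_mult)
  qed
qed

lemma pauli_mat_carrier [simp]: "pauli_mat p \<in> carrier_mat 2 2"
  by (cases p) (auto simp: mat_of_rows_list_def)

lemma sum_lessThan_2: "(\<Sum>k<2. f k) = f 0 + f (Suc 0)"
  for f :: "nat \<Rightarrow> 'a :: comm_monoid_add"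
  by (simp add: numeral_2_eq_2)

lemma pauli_mat_mult_entry:
  assumes "i = 0 \<or> i = Suc 0" "j = 0 \<or> j = Suc 0"
  shows "(\<Sum>k<2. pauli_mat p $$ (i, k) * pauli_mat p $$ (k, j)) = 1\<^sub>m 2 $$ (i, j)"
  using assms by (cases p; elim disjE; simp add: mat_of_rows_list_def sum_lessThan_2)

lemma pauli_mat_square: "pauli_mat p * pauli_mat p = 1\<^sub>m 2"
proof (rule eq_matI)
  fix i j assume "i < dim_row (1\<^sub>m 2 :: complex mat)" "j < dim_col (1\<^sub>m 2 :: complex mat)"
  then have ij: "i < 2" "j < 2" by auto
  have "(\<Sum>k<2. pauli_mat p $$ (i, k) * pauli_mat p $$ (k, j)) = 1\<^sub>m 2 $$ (i, j)"
    by (rule pauli_mat_mult_entry) (use ij in \<open>auto simp: less_2_cases_iff\<close>)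
  then show "(pauli_mat p * pauli_mat p) $$ (i, j) = 1\<^sub>m 2 $$ (i, j)"
    by (simp only: index_mult_mat_sum[OF pauli_mat_carrier pauli_mat_carrier ij])
qed (simp_all only: carrier_matD[OF mult_carrier_mat[OF pauli_mat_carrier pauli_mat_carrier]] index_one_mat)

lemma pauli_mat_cnj:
  "i < 2 \<Longrightarrow> j < 2 \<Longrightarrow> pauli_mat p $$ (i, j) = cnj (pauli_mat p $$ (j, i))"
  by (cases p) (auto simp: less_2_cases_iff mat_of_rows_list_def)

lemma hermitian_involution_pauli_mat: "hermitian_involution 2 (pauli_mat p)"
  by (intro hermitian_involutionI pauli_mat_carrier pauli_mat_square pauli_mat_cnj)

lemma hermitian_involution_pauli_op: "hermitian_involution (2 ^ length ps) (pauli_op ps)"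
proof (induction ps)
  case Nil
  show ?case by (simp add: hermitian_involution_def)
next
  case (Cons p ps)
  show ?case using hermitian_involution_kron[OF hermitian_involution_pauli_mat Cons] by simp
qed

lemma pauli_op_carrier [simp]: "pauli_op ps \<in> carrier_mat (2 ^ length ps) (2 ^ length ps)"
  by (rule hermitian_involutionD(1)[OF hermitian_involution_pauli_op])

lemma pauli_mat_transpose:
  "i < 2 \<Longrightarrow> j < 2 \<Longrightarrow> pauli_mat p $$ (j, i) = (if p = PY then - 1 else 1) * pauli_mat p $$ (i, j)"
  by (cases p) (auto simp: less_2_cases_iff mat_of_rows_list_def)

text \<open>Transposition acts on each tensor factor separately, and \<open>PY\<close> is the only
  antisymmetric letter, so each occurrence contributes one sign.\<close>

lemma pauli_op_transpose:
  assumes "i < 2 ^ length ps" "j < 2 ^ length ps"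
  shows "pauli_op ps $$ (j, i) = (- 1) ^ count_list ps PY * pauli_op ps $$ (i, j)"
  using assms
proof (induction ps arbitrary: i j)
  case (Cons p ps)
  define N where "N = (2 :: nat) ^ length ps"
  have C: "pauli_op ps \<in> carrier_mat N N" by (simp add: N_def)
  have ij: "i < 2 * N" "j < 2 * N" using Cons.prems by (auto simp: N_def)
  have d: "i div N < 2" "j div N < 2" "i mod N < N" "j mod N < N"
    using ij by (auto simp: less_mult_imp_div_less mod_less_mult)
  have "pauli_mat p $$ (j div N, i div N) = (if p = PY then - 1 else 1) * pauli_mat p $$ (i div N, j div N)"
    by (rule pauli_mat_transpose[OF d(1,2)])
  moreover have "pauli_op ps $$ (j mod N, i mod N) = (- 1) ^ count_list ps PY * pauli_op ps $$ (i mod N, j mod N)"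
    by (rule Cons.IH[folded N_def, OF d(3,4)])
  ultimately show ?case
    using ij by (simp add: index_kron[OF pauli_mat_carrier C])
qed simp

section \<open>Measuring a Hermitian involution in an eigenbasis\<close>

lemma hermitian_involution_cscalar_prod:
  assumes A: "hermitian_involution d A" and v: "v \<in> carrier_vec d" and w: "w \<in> carrier_vec d"
  shows "(A *\<^sub>v v) \<bullet>c w = v \<bullet>c (A *\<^sub>v w)"
proof -
  note C = hermitian_involutionD(1)[OF A]
  have "(A *\<^sub>v v) \<bullet>c w = (\<Sum>i<d. \<Sum>j<d. A $$ (i, j) * v $ j * cnj (w $ i))"
    using C v w by (simp add: scalar_prod_def lessThan_atLeast0 sum_distrib_right)
  also have "\<dots> = (\<Sum>j<d. \<Sum>i<d. A $$ (i, j) * v $ j * cnj (w $ i))"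
    by (rule sum.swap)
  also have "\<dots> = (\<Sum>j<d. \<Sum>i<d. v $ j * cnj (A $$ (j, i) * w $ i))"
  proof (intro sum.cong refl)
    fix i j assume "i \<in> {..<d}" "j \<in> {..<d}"
    then show "A $$ (i, j) * v $ j * cnj (w $ i) = v $ j * cnj (A $$ (j, i) * w $ i)"
      using hermitian_involutionD(3)[OF A, of i j] by simp
  qed
  also have "\<dots> = v \<bullet>c (A *\<^sub>v w)"
    using C v w by (simp add: scalar_prod_def lessThan_atLeast0 sum_distrib_left)
  finally show ?thesis .
qed

lemma hermitian_involution_mult_mult_vec:
  assumes "hermitian_involution d A" "v \<in> carrier_vec d"
  shows "A *\<^sub>v (A *\<^sub>v v) = v"
  by (metis assms assoc_mult_mat_vec hermitian_involutionD(1,2) one_mult_mat_vec)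

text \<open>The eigenvalue of an eigenvector can be read off the measured vector, whatever
  eigenbasis was used.\<close>

definition involution_sign :: "complex mat \<Rightarrow> complex vec \<Rightarrow> real" where
  "involution_sign A b = (if A *\<^sub>v b = b then 1 else - 1)"

lemma abs_involution_sign: "\<bar>involution_sign A b\<bar> \<le> 1"
  by (simp add: involution_sign_def)

text \<open>Applying \<open>A\<close> twice gives \<open>l\<^sup>2 = 1\<close>. A nonzero entry of
  \<open>b\<close> separates \<open>b\<close> from its negative, so the test in
  \<open>involution_sign\<close> recognizes the eigenvalue -1 correctly.\<close>

lemma eigenvector_involution_sign:
  assumes A: "hermitian_involution d A" and ev: "eigenvector A b l"
  shows "A *\<^sub>v b = complex_of_real (involution_sign A b) \<cdot>\<^sub>v b"
proof -
  have b: "b \<in> carrier_vec d" and b0: "b \<noteq> 0\<^sub>v d" and Ab: "A *\<^sub>v b = l \<cdot>\<^sub>v b"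
    and C: "A \<in> carrier_mat d d"
    using hermitian_involutionD(1)[OF A] ev by (auto simp: eigenvector_def)
  obtain i where i: "i < d" "b $ i \<noteq> 0" using b b0 by (metis carrier_vecD eq_vecI index_zero_vec)
  have "b = A *\<^sub>v (l \<cdot>\<^sub>v b)" using hermitian_involution_mult_mult_vec[OF A b] Ab by simp
  also have "\<dots> = l \<cdot>\<^sub>v (l \<cdot>\<^sub>v b)" using mult_mat_vec[OF C b] Ab by simp
  finally have "b $ i = l * (l * b $ i)" using b i by (metis carrier_vecD index_smult_vec smult_carrier_vec)
  then have "l\<^sup>2 = 1" using i by (simp add: power2_eq_square)
  then consider "l = 1" | "l = - 1" using power2_eq_1_iff by blast
  then show ?thesis
  proof cases
    case 1
    then show ?thesis using Ab by (simp add: involution_sign_def)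
  next
    case 2
    have "(A *\<^sub>v b) $ i \<noteq> b $ i" using b i by (simp add: Ab 2)
    then show ?thesis using Ab 2 by (auto simp: involution_sign_def)
  qed
qed

text \<open>Polarization replaces the spectral decomposition: \<open>parseval\<close> is applied to
  \<open>v + A *\<^sub>v v\<close>. Its squared norm is 2 plus twice the wanted real part, while its
  squared coefficients are those of \<open>v\<close> weighted by 2 plus twice the
  eigenvalue.\<close>

lemma expectation_measurement:
  assumes B: "orthonormal_basis d B" and A: "hermitian_involution d A"
    and ev: "\<forall>b\<in>B. \<exists>l. eigenvector A b l"
    and v: "v \<in> carrier_vec d" "v \<bullet>c v = 1"
  shows "measure_pmf.expectation (measurement B v) (involution_sign A) = Re ((A *\<^sub>v v) \<bullet>c v)"
proof -
  have fin: "finite B" and Bc: "B \<subseteq> carrier_vec d" using B by (auto simp: orthonormal_basis_def)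
  note C = hermitian_involutionD(1)[OF A]
  have Av: "A *\<^sub>v v \<in> carrier_vec d" using C v by simp
  let ?w = "v + A *\<^sub>v v"
  have w: "?w \<in> carrier_vec d" using Av v by simp
  have E: "measure_pmf.expectation (measurement B v) (involution_sign A)
      = (\<Sum>b\<in>B. involution_sign A b * (cmod (v \<bullet>c b))\<^sup>2)"
    by (subst integral_measure_pmf[OF fin])
       (auto simp: pmf_measurement[OF B v] set_pmf_eq split: if_splits intro!: sum.cong)
  have add: "(x + y) \<bullet>c z = x \<bullet>c z + y \<bullet>c z" if "x \<in> carrier_vec d" "y \<in> carrier_vec d" "z \<in> carrier_vec d"
    for x y z :: "complex vec"
    by (rule add_scalar_prod_distrib[of _ d]) (use that in auto)
  \<comment> \<open>With eigenvalue \<open>s\<close> the coefficient of \<open>v\<close> at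
    \<open>b\<close> is multiplied by \<open>1 + s\<close>, and
    \<open>(1 + s)\<^sup>2 = 2 + 2 * s\<close> since \<open>s\<close> is 1 or -1.\<close>
  have wb: "(cmod (?w \<bullet>c b))\<^sup>2 = (2 + 2 * involution_sign A b) * (cmod (v \<bullet>c b))\<^sup>2" if b: "b \<in> B" for b
  proof -
    have bc: "b \<in> carrier_vec d" using b Bc by auto
    from ev b obtain l where "eigenvector A b l" by auto
    from eigenvector_involution_sign[OF A this]
    have "(A *\<^sub>v v) \<bullet>c b = v \<bullet>c (complex_of_real (involution_sign A b) \<cdot>\<^sub>v b)"
      using hermitian_involution_cscalar_prod[OF A v(1) bc] by simp
    also have "\<dots> = complex_of_real (involution_sign A b) * (v \<bullet>c b)"
      using v bc by (simp add: conjugate_smult_vec)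
    finally have "?w \<bullet>c b = complex_of_real (1 + involution_sign A b) * (v \<bullet>c b)"
      by (simp add: add[OF v(1) Av bc] distrib_right)
    then show ?thesis
      by (simp add: norm_mult power_mult_distrib involution_sign_def del: of_real_add)
  qed
  have conj: "Re (v \<bullet>c (A *\<^sub>v v)) = Re ((A *\<^sub>v v) \<bullet>c v)"
    using hermitian_involution_cscalar_prod[OF A v(1) v(1)] by simp
  have AvAv: "(A *\<^sub>v v) \<bullet>c (A *\<^sub>v v) = 1"
    using hermitian_involution_cscalar_prod[OF A v(1) Av] hermitian_involution_mult_mult_vec[OF A v(1)] v
    by simp
  have "?w \<bullet>c ?w = v \<bullet>c v + v \<bullet>c (A *\<^sub>v v) + ((A *\<^sub>v v) \<bullet>c v + (A *\<^sub>v v) \<bullet>c (A *\<^sub>v v))"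
  proof -
    have "x \<bullet>c ?w = x \<bullet>c v + x \<bullet>c (A *\<^sub>v v)" if "x \<in> carrier_vec d" for x
      using that v Av by (simp add: conjugate_add_vec[of _ d] scalar_prod_add_distrib[of _ d])
    then show ?thesis using v(1) Av w by (simp add: add)
  qed
  then have "2 + 2 * Re ((A *\<^sub>v v) \<bullet>c v) = Re (?w \<bullet>c ?w)"
    using v(2) AvAv conj by simp
  also have "\<dots> = (\<Sum>b\<in>B. (2 + 2 * involution_sign A b) * (cmod (v \<bullet>c b))\<^sup>2)"
    unfolding parseval[OF B w, symmetric] by (intro sum.cong refl wb)
  also have "\<dots> = 2 * (\<Sum>b\<in>B. (cmod (v \<bullet>c b))\<^sup>2) + 2 * (\<Sum>b\<in>B. involution_sign A b * (cmod (v \<bullet>c b))\<^sup>2)"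
    by (simp add: sum_distrib_left distrib_right sum.distrib mult.assoc)
  also have "(\<Sum>b\<in>B. (cmod (v \<bullet>c b))\<^sup>2) = 1"
    using parseval[OF B v(1)] v(2) by simp
  finally show ?thesis unfolding E by (simp only: mult_1_right add_left_cancel mult_cancel_left) simp
qed

section \<open>The correlator as an expectation value in the vectorized unitary\<close>

lemma vectorize_nth:
  assumes U: "unitary_op d U" and k: "k < d * d"
  shows "vectorize U $ k = U $$ (k div d, k mod d) / complex_of_real (sqrt d)"
proof -
  have "mat_trace (mat_adjoint U * U) = of_nat d"
    using U by (simp add: unitary_op_def mat_trace_def)
  moreover have "csqrt (of_nat d) = complex_of_real (sqrt d)"
    using of_real_sqrt[of "real d"] by simp
  ultimately show ?thesis
    using U k by (auto simp: vectorize_def unitary_op_def)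
qed

text \<open>Brings the expectation value into the fourfold sum against which the trace is matched.
  The normalization of \<open>vectorize U\<close> enters twice, which gives the division by
  \<open>d\<close>.\<close>

lemma cscalar_prod_vectorize:
  assumes U: "unitary_op d U" and A: "A \<in> carrier_mat d d" and B: "B \<in> carrier_mat d d"
  shows "(kron A B *\<^sub>v vectorize U) \<bullet>c vectorize U =
    (\<Sum>i<d. \<Sum>j<d. \<Sum>k<d. \<Sum>l<d. A $$ (i, k) * B $$ (j, l) * U $$ (k, l) * cnj (U $$ (i, j))) / of_nat d"
proof -
  have K: "kron A B \<in> carrier_mat (d * d) (d * d)" using A B by simp
  have V: "vectorize U \<in> carrier_vec (d * d)"
    using U by (auto simp: vectorize_def unitary_op_def)
  have sq: "complex_of_real (sqrt d) * complex_of_real (sqrt d) = of_nat d"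
    by (simp flip: of_real_mult)
  have "(kron A B *\<^sub>v vectorize U) \<bullet>c vectorize U
      = (\<Sum>p<d * d. (\<Sum>q<d * d. kron A B $$ (p, q) * vectorize U $ q) * cnj (vectorize U $ p))"
    using K V by (simp add: scalar_prod_def lessThan_atLeast0)
  also have "\<dots> = (\<Sum>p<d * d. \<Sum>q<d * d. A $$ (p div d, q div d) * B $$ (p mod d, q mod d) *
      U $$ (q div d, q mod d) * cnj (U $$ (p div d, p mod d)) / of_nat d)"
    by (simp add: sum_distrib_right index_kron[OF A B] vectorize_nth[OF U] sq[symmetric] sum_divide_distrib)
  also have "\<dots> = (\<Sum>p<d * d. \<Sum>k<d. \<Sum>l<d. A $$ (p div d, k) * B $$ (p mod d, l) *
      U $$ (k, l) * cnj (U $$ (p div d, p mod d)) / of_nat d)"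
    by (intro sum.cong refl sum_div_mod)
  also have "\<dots> = (\<Sum>i<d. \<Sum>j<d. \<Sum>k<d. \<Sum>l<d. A $$ (i, k) * B $$ (j, l) *
      U $$ (k, l) * cnj (U $$ (i, j)) / of_nat d)"
    by (rule sum_div_mod)
  finally show ?thesis by (simp add: sum_divide_distrib)
qed

text \<open>Written in entries, the trace contracts P with its indices in the opposite order from
  the expectation value. \<open>pauli_op_transpose\<close> repairs this at the price of the sign,
  and what remains is a reordering of four finite sums.\<close>

lemma correlator_eq:
  assumes U: "unitary_op (2 ^ n) U" and P: "length P = n" and Q: "length Q = n"
  shows "correlator n U (pauli_op P) (pauli_op Q) =
    (- 1) ^ count_list P PY * ((kron (pauli_op Q) (pauli_op P) *\<^sub>v vectorize U) \<bullet>c vectorize U)"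
proof -
  define d where "d = (2 :: nat) ^ n"
  define A where "A = pauli_op Q"
  define B where "B = pauli_op P"
  define F where "F = (\<lambda>i j k l. A $$ (i, k) * B $$ (j, l) * U $$ (k, l) * cnj (U $$ (i, j)))"
  let ?s = "(- 1) ^ count_list P PY :: complex"
  have A: "A \<in> carrier_mat d d" and B: "B \<in> carrier_mat d d"
    using pauli_op_carrier[of Q] pauli_op_carrier[of P] P Q by (simp_all add: A_def B_def d_def)
  have U': "unitary_op d U" using U by (simp add: d_def)
  then have Uc: "U \<in> carrier_mat d d" by (simp add: unitary_op_def)
  have adj: "mat_adjoint U \<in> carrier_mat d d" "\<And>i j. i < d \<Longrightarrow> j < d \<Longrightarrow> mat_adjoint U $$ (i, j) = cnj (U $$ (j, i))"
    using Uc by (auto simp: mat_adjoint_def mat_of_rows_def cols_def)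
  have AU: "mat_adjoint U * A \<in> carrier_mat d d" using adj A by simp
  have AUU: "mat_adjoint U * A * U \<in> carrier_mat d d" using AU Uc by simp
  have "mat_trace (B * (mat_adjoint U * A * U)) = (\<Sum>l<d. (B * (mat_adjoint U * A * U)) $$ (l, l))"
    using B by (simp add: mat_trace_def)
  also have "\<dots> = (\<Sum>l<d. \<Sum>j<d. \<Sum>k<d. \<Sum>i<d. B $$ (l, j) * (cnj (U $$ (i, j)) * A $$ (i, k) * U $$ (k, l)))"
    by (simp add: index_mult_mat_sum[OF B AUU] index_mult_mat_sum[OF AU Uc] index_mult_mat_sum[OF adj(1) A]
        adj(2) sum_distrib_left sum_distrib_right mult.assoc)
  also have "\<dots> = (\<Sum>l<d. \<Sum>j<d. \<Sum>k<d. \<Sum>i<d. ?s * F i j k l)"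
  proof (intro sum.cong refl)
    fix l j k i assume "l \<in> {..<d}" "j \<in> {..<d}"
    then have "B $$ (l, j) = ?s * B $$ (j, l)"
      unfolding B_def by (intro pauli_op_transpose) (auto simp: d_def P)
    then show "B $$ (l, j) * (cnj (U $$ (i, j)) * A $$ (i, k) * U $$ (k, l)) =
        ?s * F i j k l"
      by (simp add: F_def)
  qed
  \<comment> \<open>Five adjacent interchanges take the summation order \<open>l j k i\<close> to
    \<open>i j k l\<close>.\<close>
  also have "\<dots> = (\<Sum>j<d. \<Sum>l<d. \<Sum>k<d. \<Sum>i<d. ?s * F i j k l)"
    by (rule sum.swap)
  also have "\<dots> = (\<Sum>j<d. \<Sum>l<d. \<Sum>i<d. \<Sum>k<d. ?s * F i j k l)"
    by (rule sum.cong[OF refl], rule sum.cong[OF refl], rule sum.swap)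
  also have "\<dots> = (\<Sum>j<d. \<Sum>i<d. \<Sum>l<d. \<Sum>k<d. ?s * F i j k l)"
    by (rule sum.cong[OF refl], rule sum.swap)
  also have "\<dots> = (\<Sum>i<d. \<Sum>j<d. \<Sum>l<d. \<Sum>k<d. ?s * F i j k l)"
    by (rule sum.swap)
  also have "\<dots> = (\<Sum>i<d. \<Sum>j<d. \<Sum>k<d. \<Sum>l<d. ?s * F i j k l)"
    by (rule sum.cong[OF refl], rule sum.cong[OF refl], rule sum.swap)
  also have "\<dots> = ?s * (\<Sum>i<d. \<Sum>j<d. \<Sum>k<d. \<Sum>l<d. F i j k l)"
    by (simp only: sum_distrib_left)
  finally show ?thesis
    unfolding correlator_def A_def[symmetric] B_def[symmetric] cscalar_prod_vectorize[OF U' A B]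
    by (simp add: d_def F_def)
qed

section \<open>Existence of a common eigenbasis\<close>

lemma cscalar_prod_conj_commute:
  fixes v w :: "complex vec"
  assumes "v \<in> carrier_vec d" "w \<in> carrier_vec d"
  shows "w \<bullet>c v = cnj (v \<bullet>c w)"
  using assms by (simp add: scalar_prod_def mult.commute)

lemma eq_uminus_if_add_eq_zero_vec:
  fixes u v :: "complex vec"
  assumes v: "v \<in> carrier_vec d" and u: "u \<in> carrier_vec d" and 0: "v + u = 0\<^sub>v d"
  shows "u = (- 1) \<cdot>\<^sub>v v"
proof (rule eq_vecI)
  fix i assume "i < dim_vec ((- 1) \<cdot>\<^sub>v v)"
  then have i: "i < d" using v by simp
  have "(v + u) $ i = 0" using i unfolding 0 by simp
  then have "u $ i + v $ i = 0" using i u by (simp add: add.commute)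
  then show "u $ i = ((- 1) \<cdot>\<^sub>v v) $ i" using i v by (simp add: eq_neg_iff_add_eq_0)
qed (use u v in auto)

text \<open>The conjugated vectors of \<open>B\<close> are the rows of a square matrix padded with
  zero rows. Its determinant vanishes, and a nonzero kernel vector is orthogonal to all of
  \<open>B\<close>.\<close>

lemma ex_orthogonal_vec:
  fixes B :: "complex vec set"
  assumes B: "finite B" "B \<subseteq> carrier_vec d" "card B < d"
  obtains w where "w \<in> carrier_vec d" "w \<noteq> 0\<^sub>v d" "\<And>b. b \<in> B \<Longrightarrow> w \<bullet>c b = 0"
proof -
  obtain bs where bs: "set bs = B" "distinct bs" "length bs = card B"
    using finite_distinct_list[OF B(1)] distinct_card by metis
  define c where "c = (\<lambda>i. if i < length bs then conjugate (bs ! i) else 0\<^sub>v d)"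
  \<comment> \<open>Row \<open>d - 1\<close> is free for the zero vector: \<open>card B < d\<close>
    keeps every position in \<open>bs\<close> below \<open>d - 1\<close>.\<close>
  define R where "R = mat\<^sub>r d d (\<lambda>i. if i = d - 1 then 0\<^sub>v d else c i)"
  have c: "c i \<in> carrier_vec d" for i
  proof (cases "i < length bs")
    case True
    then have "bs ! i \<in> carrier_vec d" using bs(1) B(2) nth_mem by blast
    then show ?thesis using True by (simp add: c_def)
  qed (simp add: c_def)
  have "det R = 0" unfolding R_def by (rule det_row_0) (use B c in auto)
  moreover have R: "R \<in> carrier_mat d d" by (simp add: R_def)
  ultimately obtain w where w: "w \<in> carrier_vec d" "w \<noteq> 0\<^sub>v d" "R *\<^sub>v w = 0\<^sub>v d"
    using det_0_iff_vec_prod_zero by blast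
  have "w \<bullet>c b = 0" if "b \<in> B" for b
  proof -
    obtain i where i: "i < length bs" "b = bs ! i" using \<open>b \<in> B\<close> bs(1) by (metis in_set_conv_nth)
    have id: "i < d" "i \<noteq> d - 1" using i bs B by auto
    have bc: "b \<in> carrier_vec d" using that B by auto
    have "row R i = c i"
      unfolding R_def using id carrier_vecD[OF c[of i]] by (subst row_mat_of_row_fun) auto
    then have "row R i = conjugate b" using i by (simp add: c_def)
    then have "conjugate b \<bullet> w = 0"
      using w(3) id R by (metis carrier_matD(1) index_mult_mat_vec index_zero_vec(1))
    then show ?thesis using conjugate_vec_sprod_comm[OF w(1) bc] by simp
  qed
  with w that show ?thesis by blast
qed

text \<open>If \<open>A\<close> is an involution, then either \<open>A w = - w\<close> or \<open>w + A w\<close> is an eigenvector for the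
  eigenvalue 1; the second replacement preserves the eigenvector equations of matrices that commute
  with \<open>A\<close>.\<close>

lemma ex_orthogonal_common_eigenvector:
  assumes fin: "finite \<A>" and inv: "\<And>A. A \<in> \<A> \<Longrightarrow> hermitian_involution d A"
    and comm: "\<And>A A'. A \<in> \<A> \<Longrightarrow> A' \<in> \<A> \<Longrightarrow> A * A' = A' * A"
    and B: "finite B" "B \<subseteq> carrier_vec d" "card B < d"
    and ev: "\<And>A b. A \<in> \<A> \<Longrightarrow> b \<in> B \<Longrightarrow> \<exists>l. A *\<^sub>v b = l \<cdot>\<^sub>v b"
  shows "\<exists>w. w \<in> carrier_vec d \<and> w \<noteq> 0\<^sub>v d \<and> (\<forall>b\<in>B. w \<bullet>c b = 0) \<and> (\<forall>A\<in>\<A>. \<exists>l. A *\<^sub>v w = l \<cdot>\<^sub>v w)"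
  using fin inv comm ev
proof (induction \<A> rule: finite_induct)
  case empty
  then show ?case using ex_orthogonal_vec[OF B] by (metis empty_iff)
next
  case (insert A \<A>)
  have "\<exists>w. w \<in> carrier_vec d \<and> w \<noteq> 0\<^sub>v d \<and> (\<forall>b\<in>B. w \<bullet>c b = 0) \<and> (\<forall>A\<in>\<A>. \<exists>l. A *\<^sub>v w = l \<cdot>\<^sub>v w)"
    by (rule insert.IH) (use insert.prems in \<open>blast+\<close>)
  then obtain w where w: "w \<in> carrier_vec d" "w \<noteq> 0\<^sub>v d" "\<And>b. b \<in> B \<Longrightarrow> w \<bullet>c b = 0"
    and evw: "\<And>A'. A' \<in> \<A> \<Longrightarrow> \<exists>l. A' *\<^sub>v w = l \<cdot>\<^sub>v w"
    by blast
  have hA: "hermitian_involution d A" using insert.prems by blast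
  then have AC: "A \<in> carrier_mat d d" by (rule hermitian_involutionD(1))
  have Aw: "A *\<^sub>v w \<in> carrier_vec d" using AC w by simp
  have AAw: "A *\<^sub>v (A *\<^sub>v w) = w" by (rule hermitian_involution_mult_mult_vec[OF hA w(1)])
  show ?case
  proof (cases "w + A *\<^sub>v w = 0\<^sub>v d")
    case True
    have "A *\<^sub>v w = (- 1) \<cdot>\<^sub>v w"
      by (rule eq_uminus_if_add_eq_zero_vec[OF w(1) Aw True])
    then show ?thesis using w evw by blast
  next
    case False
    \<comment> \<open>Orthogonality to \<open>B\<close> survives because \<open>A\<close> is
      Hermitian and maps each \<open>b\<close> to a multiple of itself.\<close>
    have orth: "(w + A *\<^sub>v w) \<bullet>c b = 0" if b: "b \<in> B" for b
    proof -
      have bc: "b \<in> carrier_vec d" using b B by auto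
      obtain l where l: "A *\<^sub>v b = l \<cdot>\<^sub>v b" using insert.prems b by blast
      have "(A *\<^sub>v w) \<bullet>c b = w \<bullet>c (l \<cdot>\<^sub>v b)"
        using hermitian_involution_cscalar_prod[OF hA w(1) bc] l by simp
      also have "\<dots> = 0" using w bc b by (simp add: conjugate_smult_vec)
      finally show ?thesis
        using add_scalar_prod_distrib[OF w(1) Aw, of "conjugate b"] bc w(3)[OF b] by simp
    qed
    have "A *\<^sub>v (w + A *\<^sub>v w) = 1 \<cdot>\<^sub>v (w + A *\<^sub>v w)"
      using mult_add_distrib_mat_vec[OF AC w(1) Aw] AAw comm_add_vec[OF w(1) Aw] by simp
    moreover have "\<exists>l. A' *\<^sub>v (w + A *\<^sub>v w) = l \<cdot>\<^sub>v (w + A *\<^sub>v w)" if A': "A' \<in> \<A>" for A'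
    proof -
      obtain l where l: "A' *\<^sub>v w = l \<cdot>\<^sub>v w" using evw A' by blast
      have A'C: "A' \<in> carrier_mat d d" using insert.prems A' by (blast intro: hermitian_involutionD(1))
      have "A' *\<^sub>v (A *\<^sub>v w) = (A' * A) *\<^sub>v w"
        using assoc_mult_mat_vec[OF A'C AC w(1)] by simp
      also have "\<dots> = (A * A') *\<^sub>v w" using insert.prems(2)[of A A'] A' by simp
      also have "\<dots> = A *\<^sub>v (l \<cdot>\<^sub>v w)" using assoc_mult_mat_vec[OF AC A'C w(1)] l by simp
      also have "\<dots> = l \<cdot>\<^sub>v (A *\<^sub>v w)" by (rule mult_mat_vec[OF AC w(1)])
      finally have "A' *\<^sub>v (w + A *\<^sub>v w) = l \<cdot>\<^sub>v (w + A *\<^sub>v w)"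
        using mult_add_distrib_mat_vec[OF A'C w(1) Aw] l smult_add_distrib_vec[OF w(1) Aw] by simp
      then show ?thesis by blast
    qed
    moreover have "w + A *\<^sub>v w \<in> carrier_vec d" using w Aw by simp
    ultimately show ?thesis using False orth by blast
  qed
qed

lemma ex_normalized:
  fixes w :: "complex vec"
  assumes w: "w \<in> carrier_vec d" "w \<noteq> 0\<^sub>v d"
  obtains c where "(c \<cdot>\<^sub>v w) \<bullet>c (c \<cdot>\<^sub>v w) = 1"
proof -
  define s where "s = (\<Sum>i<d. (cmod (w $ i))\<^sup>2)"
  have ws: "w \<bullet>c w = complex_of_real s"
    using w(1) unfolding s_def of_real_sum complex_norm_square by (simp add: scalar_prod_def lessThan_atLeast0)
  obtain i where "i < d" "w $ i \<noteq> 0" using w by (metis carrier_vecD eq_vecI index_zero_vec)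
  then have s: "s > 0" unfolding s_def by (intro sum_pos2[of _ i]) auto
  define c where "c = complex_of_real (1 / sqrt s)"
  have "(c \<cdot>\<^sub>v w) \<bullet>c (c \<cdot>\<^sub>v w) = c * c * (w \<bullet>c w)"
    using w(1) by (simp add: conjugate_smult_vec c_def)
  also have "\<dots> = 1"
    using s unfolding c_def ws by (simp flip: of_real_mult add: real_sqrt_mult_self)
  finally show ?thesis by (rule that)
qed

text \<open>An orthonormal set of common eigenvectors is enlarged one normalized vector at a time
  until it has \<open>d\<close> elements.\<close>

lemma ex_common_eigenbasis:
  assumes fin: "finite \<A>" and inv: "\<And>A. A \<in> \<A> \<Longrightarrow> hermitian_involution d A"
    and comm: "\<And>A A'. A \<in> \<A> \<Longrightarrow> A' \<in> \<A> \<Longrightarrow> A * A' = A' * A"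
  shows "\<exists>B. common_eigenbasis d \<A> B"
proof -
  have "k \<le> d \<Longrightarrow> \<exists>B. B \<subseteq> carrier_vec d \<and> finite B \<and> card B = k \<and>
      (\<forall>b\<in>B. \<forall>c\<in>B. b \<bullet>c c = (if b = c then 1 else 0)) \<and> (\<forall>A\<in>\<A>. \<forall>b\<in>B. \<exists>l. A *\<^sub>v b = l \<cdot>\<^sub>v b)" for k
  proof (induction k)
    case 0
    show ?case by (rule exI[of _ "{}"]) simp
  next
    case (Suc k)
    then obtain B where B: "B \<subseteq> carrier_vec d" "finite B" "card B = k"
      and on: "\<And>b c. b \<in> B \<Longrightarrow> c \<in> B \<Longrightarrow> b \<bullet>c c = (if b = c then 1 else 0)"
      and ev: "\<And>A b. A \<in> \<A> \<Longrightarrow> b \<in> B \<Longrightarrow> \<exists>l. A *\<^sub>v b = l \<cdot>\<^sub>v b"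
      by (metis Suc_leD)
    have "card B < d" using B Suc.prems by simp
    from ex_orthogonal_common_eigenvector[OF fin inv comm B(2,1) this ev]
    obtain w where w: "w \<in> carrier_vec d" "w \<noteq> 0\<^sub>v d" "\<And>b. b \<in> B \<Longrightarrow> w \<bullet>c b = 0"
      and evw: "\<And>A. A \<in> \<A> \<Longrightarrow> \<exists>l. A *\<^sub>v w = l \<cdot>\<^sub>v w" by blast
    obtain c where c: "(c \<cdot>\<^sub>v w) \<bullet>c (c \<cdot>\<^sub>v w) = 1" using ex_normalized[OF w(1,2)] by blast
    define u where "u = c \<cdot>\<^sub>v w"
    have u: "u \<in> carrier_vec d" "u \<bullet>c u = 1" using w c by (auto simp: u_def)
    have ub: "u \<bullet>c b = 0" if "b \<in> B" for b
    proof -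
      have "b \<in> carrier_vec d" using that B by auto
      then show ?thesis using w(1) w(3)[OF that] by (simp add: u_def)
    qed
    have bu: "b \<bullet>c u = 0" if "b \<in> B" for b
      using cscalar_prod_conj_commute[of u d b] u ub[OF that] B that by auto
    have "u \<notin> B" using ub u by force
    moreover have "\<exists>l. A *\<^sub>v u = l \<cdot>\<^sub>v u" if A: "A \<in> \<A>" for A
    proof -
      obtain l where "A *\<^sub>v w = l \<cdot>\<^sub>v w" using evw[OF A] by blast
      moreover have "A \<in> carrier_mat d d" by (rule hermitian_involutionD(1)[OF inv[OF A]])
      ultimately have "A *\<^sub>v u = l \<cdot>\<^sub>v u"
        using w(1) by (simp add: u_def mult_mat_vec[of _ d d] smult_smult_assoc mult.commute)
      then show ?thesis by blast
    qed
    ultimately show ?case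
      using B u on ub bu ev by (intro exI[of _ "insert u B"]) auto
  qed
  then obtain B where B: "B \<subseteq> carrier_vec d" "finite B" "card B = d"
    and on: "\<forall>b\<in>B. \<forall>c\<in>B. b \<bullet>c c = (if b = c then 1 else 0)"
    and ev: "\<forall>A\<in>\<A>. \<forall>b\<in>B. \<exists>l. A *\<^sub>v b = l \<cdot>\<^sub>v b" by (metis order_refl)
  \<comment> \<open>The induction tracks only the eigenvector equations; the unit norm now supplies
    the nonvanishing that \<open>eigenvector\<close> demands.\<close>
  have nz: "b \<noteq> 0\<^sub>v d" if "b \<in> B" for b
    using on that by force
  have "eigenvector A b l" if "A \<in> \<A>" "b \<in> B" "A *\<^sub>v b = l \<cdot>\<^sub>v b" for A b l
    using that nz B hermitian_involutionD(1)[OF inv[of A]] by (auto simp: eigenvector_def)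
  then have "common_eigenbasis d \<A> B"
    unfolding common_eigenbasis_def orthonormal_basis_def using B on ev by blast
  then show ?thesis by blast
qed

section \<open>Simultaneous estimation and the number of samples\<close>

text \<open>All \<open>M\<close> estimates are computed from the same outcomes and may be
  correlated, so their failure probabilities are combined by a union bound.\<close>

lemma replicate_measurement_bound:
  fixes A :: "nat \<Rightarrow> complex mat" and s :: "nat \<Rightarrow> real" and r :: "nat \<Rightarrow> complex"
  assumes B: "common_eigenbasis d (A ` {..<M}) B" and A: "\<And>i. i < M \<Longrightarrow> hermitian_involution d (A i)"
    and v: "v \<in> carrier_vec d" "v \<bullet>c v = 1"
    and s: "\<And>i. \<bar>s i\<bar> = 1" and r: "\<And>i. i < M \<Longrightarrow> r i = complex_of_real (s i) * ((A i *\<^sub>v v) \<bullet>c v)"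
    and e: "0 < e" and N: "0 < N"
  shows "1 - real M * (2 * exp (- real N * e\<^sup>2 / 2)) \<le>
    measure_pmf.prob (replicate_pmf N (measurement B v))
      {xs. \<forall>i<M. cmod (complex_of_real (s i * (sum_list (map (involution_sign (A i)) xs) / real N)) - r i) \<le> e}"
proof -
  let ?p = "measurement B v"
  let ?P = "measure_pmf.prob (replicate_pmf N ?p)"
  let ?f = "\<lambda>i. involution_sign (A i)"
  define bad where "bad = (\<lambda>i. {xs. e < \<bar>sum_list (map (?f i) xs) / real N - measure_pmf.expectation ?p (?f i)\<bar>})"
  define good where "good = {xs. \<forall>i<M. cmod (complex_of_real (s i * (sum_list (map (?f i) xs) / real N)) - r i) \<le> e}"
  have ob: "orthonormal_basis d B" and ev: "\<And>i. i < M \<Longrightarrow> \<forall>b\<in>B. \<exists>l. eigenvector (A i) b l"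
    using B by (auto simp: common_eigenbasis_def)
  \<comment> \<open>\<open>expectation_measurement\<close> yields only a real part; Hermiticity
    makes the full inner product real.\<close>
  have rE: "r i = complex_of_real (s i * measure_pmf.expectation ?p (?f i))" if i: "i < M" for i
  proof -
    let ?z = "(A i *\<^sub>v v) \<bullet>c v"
    have Av: "A i *\<^sub>v v \<in> carrier_vec d" using hermitian_involutionD(1)[OF A[OF i]] v by simp
    have "cnj ?z = ?z"
      using cscalar_prod_conj_commute[OF Av v(1)] hermitian_involution_cscalar_prod[OF A[OF i] v(1) v(1)]
      by simp
    then have "?z = complex_of_real (Re ?z)" by (simp add: complex_eq_iff)
    also have "Re ?z = measure_pmf.expectation ?p (?f i)"
      by (rule expectation_measurement[OF ob A[OF i] ev[OF i] v, symmetric])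
    finally show ?thesis using r[OF i] by simp
  qed
  \<comment> \<open>A sign of modulus 1 leaves the deviation unchanged, so the error in the
    correlator is the error of the empirical mean.\<close>
  have dev: "cmod (complex_of_real (s i * x) - r i) = \<bar>x - measure_pmf.expectation ?p (?f i)\<bar>" if "i < M" for i x
  proof -
    have "complex_of_real (s i * x) - r i = complex_of_real (s i * (x - measure_pmf.expectation ?p (?f i)))"
      by (simp add: rE[OF that] right_diff_distrib)
    then show ?thesis by (simp only: norm_of_real abs_mult s mult_1)
  qed
  have "good = {xs. \<forall>i<M. \<bar>sum_list (map (?f i) xs) / real N - measure_pmf.expectation ?p (?f i)\<bar> \<le> e}"
    unfolding good_def by (simp only: dev cong: imp_cong)
  then have "- good \<subseteq> (\<Union>i<M. bad i)" by (auto simp: bad_def not_le)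
  then have "?P (- good) \<le> ?P (\<Union>i<M. bad i)" by (intro measure_pmf.finite_measure_mono) auto
  also have "\<dots> \<le> (\<Sum>i<M. ?P (bad i))"
    by (rule measure_pmf.finite_measure_subadditive_finite) auto
  also have "\<dots> \<le> (\<Sum>i<M. 2 * exp (- real N * e\<^sup>2 / 2))"
    unfolding bad_def by (intro sum_mono Hoeffding_replicate_pmf abs_involution_sign e N)
  finally have "?P (- good) \<le> real M * (2 * exp (- real N * e\<^sup>2 / 2))" by simp
  moreover have "?P (- good) = 1 - ?P good"
    using measure_pmf.prob_compl[of good "replicate_pmf N ?p"] by (simp add: Compl_eq_Diff_UNIV)
  ultimately show ?thesis unfolding good_def by linarith
qed

text \<open>With \<open>L = ln (M / \<delta>)\<close>, about
  \<open>4 * L / \<epsilon>\<^sup>2\<close> samples make the exponential at most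
  \<open>(\<delta> / M)\<^sup>2\<close>. The spare factor \<open>\<delta> / M\<close> absorbs both
  the union bound and the 2 of the two-sided tail, as \<open>2 * \<delta> \<le> 1\<close>.\<close>

lemma sample_size:
  fixes \<epsilon> \<delta> :: real
  assumes M: "M \<ge> 1" and e: "0 < \<epsilon>" "\<epsilon> < 1" and d: "0 < \<delta>" "\<delta> \<le> 1 / 2"
  obtains N :: nat where "0 < N" "real N \<le> 6 * ln (real M / \<delta>) / \<epsilon>\<^sup>2"
    "real M * (2 * exp (- real N * \<epsilon>\<^sup>2 / 2)) \<le> \<delta>"
proof -
  define L where "L = ln (real M / \<delta>)"
  define N where "N = nat \<lceil>4 * L / \<epsilon>\<^sup>2\<rceil>"
  have "2 \<le> real M / \<delta>" using M d by (simp add: field_simps)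
  then have "ln 2 \<le> L" unfolding L_def by (subst ln_le_cancel_iff) auto
  then have L: "1 / 2 \<le> L" using ln2_ge_two_thirds by linarith
  have e2: "0 < \<epsilon>\<^sup>2" "\<epsilon>\<^sup>2 \<le> 1" using e by (auto simp: power_le_one)
  have "0 < 4 * L / \<epsilon>\<^sup>2" using L e2 by simp
  then have N0: "0 < N" by (simp add: N_def)
  \<comment> \<open>Rounding up costs at most one sample, which
    \<open>2 * L / \<epsilon>\<^sup>2\<close> covers because \<open>L \<ge> 1 / 2\<close>; this is
    how 4 becomes 6.\<close>
  have "1 \<le> 2 * L / \<epsilon>\<^sup>2" using L e2 by (simp add: field_simps)
  moreover have "real N \<le> 4 * L / \<epsilon>\<^sup>2 + 1" using \<open>0 < 4 * L / \<epsilon>\<^sup>2\<close> unfolding N_def by linarith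
  ultimately have N1: "real N \<le> 6 * L / \<epsilon>\<^sup>2" by simp
  have "4 * L / \<epsilon>\<^sup>2 \<le> real N" unfolding N_def by linarith
  then have "2 * L \<le> real N * \<epsilon>\<^sup>2 / 2" using e2 by (simp add: field_simps)
  then have "exp (- real N * \<epsilon>\<^sup>2 / 2) \<le> exp (- L + - L)" by simp
  also have "\<dots> = (\<delta> / real M) * (\<delta> / real M)"
    using M d unfolding exp_add L_def by (simp add: exp_minus)
  finally have "real M * (2 * exp (- real N * \<epsilon>\<^sup>2 / 2)) \<le> real M * (2 * ((\<delta> / real M) * (\<delta> / real M)))"
    by (intro mult_left_mono) auto
  also have "\<dots> = \<delta> * (2 * \<delta> / real M)" using M by simp
  also have "\<dots> \<le> \<delta> * 1" using M d by (intro mult_left_mono) (auto simp: field_simps)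
  finally show ?thesis using that[OF N0] N1 unfolding L_def by simp
qed

text \<open>Choosing \<open>N\<close> and \<open>est\<close> ahead of \<open>B\<close> and
  \<open>U\<close> expresses that the post-processing learns about U only through the outcomes. The
  existence of an eigenbasis is part of the claim so that the guarantee for every eigenbasis is not
  vacuous.\<close>

theorem theorem4:
  shows "\<exists>C\<^sub>0 :: real. C\<^sub>0 > 0 \<and>
    (\<forall>(n :: nat) (M :: nat) (P :: nat \<Rightarrow> pauli list) (Q :: nat \<Rightarrow> pauli list) (\<epsilon> :: real) (\<delta> :: real).
      n \<ge> 1 \<longrightarrow> M \<ge> 1 \<longrightarrow>
      (\<forall>i<M. length (P i) = n \<and> length (Q i) = n) \<longrightarrow>
      (\<forall>i<M. \<forall>j<M.
         kron (pauli_op (P i)) (pauli_op (Q i)) * kron (pauli_op (P j)) (pauli_op (Q j)) =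
         kron (pauli_op (P j)) (pauli_op (Q j)) * kron (pauli_op (P i)) (pauli_op (Q i))) \<longrightarrow>
      0 < \<epsilon> \<longrightarrow> \<epsilon> < 1 \<longrightarrow> 0 < \<delta> \<longrightarrow> \<delta> \<le> 1 / 2 \<longrightarrow>
      (let eigenbasis = common_eigenbasis (2 ^ n * 2 ^ n)
             ((\<lambda>i. kron (pauli_op (Q i)) (pauli_op (P i))) ` {..<M})
       in (\<exists>B. eigenbasis B) \<and>
          (\<exists>(N :: nat) (est :: complex vec list \<Rightarrow> nat \<Rightarrow> real).
             real N \<le> C\<^sub>0 * ln (real M / \<delta>) / \<epsilon>\<^sup>2 \<and>
             (\<forall>B U. eigenbasis B \<longrightarrow> unitary_op (2 ^ n) U \<longrightarrow>
                measure_pmf.prob (replicate_pmf N (measurement B (vectorize U)))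
                  {outcomes. \<forall>i<M.
                     cmod (complex_of_real (est outcomes i)
                           - correlator n U (pauli_op (P i)) (pauli_op (Q i))) \<le> \<epsilon>}
                \<ge> 1 - \<delta>))))"
proof (rule exI[of _ 6], intro conjI allI impI)
  fix n M :: nat and P Q :: "nat \<Rightarrow> pauli list" and \<epsilon> \<delta> :: real
  assume M: "1 \<le> M"
    and len: "\<forall>i<M. length (P i) = n \<and> length (Q i) = n"
    and comm: "\<forall>i<M. \<forall>j<M.
       kron (pauli_op (P i)) (pauli_op (Q i)) * kron (pauli_op (P j)) (pauli_op (Q j)) =
       kron (pauli_op (P j)) (pauli_op (Q j)) * kron (pauli_op (P i)) (pauli_op (Q i))"
    and e: "0 < \<epsilon>" "\<epsilon> < 1" and d: "0 < \<delta>" "\<delta> \<le> 1 / 2"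
  define A where "A = (\<lambda>i. kron (pauli_op (Q i)) (pauli_op (P i)))"
  define s where "s = (\<lambda>i. (- 1 :: real) ^ count_list (P i) PY)"
  have PQ: "pauli_op (P i) \<in> carrier_mat (2 ^ n) (2 ^ n)" "pauli_op (Q i) \<in> carrier_mat (2 ^ n) (2 ^ n)"
    if "i < M" for i
    using len that pauli_op_carrier[of "P i"] pauli_op_carrier[of "Q i"] by auto
  have A: "hermitian_involution (2 ^ n * 2 ^ n) (A i)" if "i < M" for i
    using hermitian_involution_kron[OF hermitian_involution_pauli_op[of "Q i"]
        hermitian_involution_pauli_op[of "P i"]] len that by (simp add: A_def)
  have Acomm: "A i * A j = A j * A i" if "i < M" "j < M" for i j
    unfolding A_def
    by (rule commute_kron_swap[OF PQ[OF that(1)] PQ[OF that(2)] comm[rule_format, OF that]])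
  obtain N where N: "0 < N" "real N \<le> 6 * ln (real M / \<delta>) / \<epsilon>\<^sup>2"
    "real M * (2 * exp (- real N * \<epsilon>\<^sup>2 / 2)) \<le> \<delta>"
    using sample_size[OF M e d] by blast
  \<comment> \<open>The sign undoes the transposition of P. The eigenvalues are read off the outcome
    vectors themselves, which makes one estimator serve every eigenbasis.\<close>
  define est where "est = (\<lambda>xs i. s i * (sum_list (map (involution_sign (A i)) xs) / real N))"
  have basis: "\<exists>B. common_eigenbasis (2 ^ n * 2 ^ n) (A ` {..<M}) B"
    by (rule ex_common_eigenbasis) (use A Acomm in auto)
  have good: "1 - \<delta> \<le> measure_pmf.prob (replicate_pmf N (measurement B (vectorize U)))
      {xs. \<forall>i<M. cmod (complex_of_real (est xs i) - correlator n U (pauli_op (P i)) (pauli_op (Q i))) \<le> \<epsilon>}"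
    if B: "common_eigenbasis (2 ^ n * 2 ^ n) (A ` {..<M}) B" and U: "unitary_op (2 ^ n) U" for B U
  proof -
    have "1 - \<delta> \<le> 1 - real M * (2 * exp (- real N * \<epsilon>\<^sup>2 / 2))" using N(3) by simp
    also have "\<dots> \<le> measure_pmf.prob (replicate_pmf N (measurement B (vectorize U)))
      {xs. \<forall>i<M. cmod (complex_of_real (est xs i) - correlator n U (pauli_op (P i)) (pauli_op (Q i))) \<le> \<epsilon>}"
      unfolding est_def
    proof (rule replicate_measurement_bound[OF B A])
      show "correlator n U (pauli_op (P i)) (pauli_op (Q i)) =
          complex_of_real (s i) * ((A i *\<^sub>v vectorize U) \<bullet>c vectorize U)" if "i < M" for i
        using correlator_eq[OF U, of "P i" "Q i"] len that by (simp add: s_def A_def)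
    qed (use vectorize_unitary_op[OF U] e N in \<open>auto simp: s_def power_abs\<close>)
    finally show ?thesis .
  qed
  show "let eigenbasis = common_eigenbasis (2 ^ n * 2 ^ n)
           ((\<lambda>i. kron (pauli_op (Q i)) (pauli_op (P i))) ` {..<M})
     in (\<exists>B. eigenbasis B) \<and>
        (\<exists>(N :: nat) (est :: complex vec list \<Rightarrow> nat \<Rightarrow> real).
           real N \<le> 6 * ln (real M / \<delta>) / \<epsilon>\<^sup>2 \<and>
           (\<forall>B U. eigenbasis B \<longrightarrow> unitary_op (2 ^ n) U \<longrightarrow>
              measure_pmf.prob (replicate_pmf N (measurement B (vectorize U)))
                {outcomes. \<forall>i<M.
                   cmod (complex_of_real (est outcomes i)
                         - correlator n U (pauli_op (P i)) (pauli_op (Q i))) \<le> \<epsilon>}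
              \<ge> 1 - \<delta>))"
    unfolding Let_def A_def[symmetric] using basis N(2) good by blast
qed simp

end
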